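(* Let $\mathcal T_h$ be a shape-regular quadrilateral or hexahedral mesh. Then there exists a constant $C_{\mathcal T_h}>0$, independent of $h$, such that for all $\widetilde{\mathbf v}_h\in\mathbf S_h^1$ with $|\widetilde{\mathbf v}_h(\mathbf z)|\ge1$ for all $\mathbf z\in\mathcal Q$, $$\|\nabla\mathbf v_h\|_h^2\le C_{\mathcal T_h}\|\nabla\widetilde{\mathbf v}_h\|_h^2,\qquad\text{where }\ \mathbf v_h=I_h\Big(\frac{\widetilde{\mathbf v}_h}{|\widetilde{\mathbf v}_h|}\Big).$$ In particular, if $\mathcal T_h$ is a Cartesian rectangular/cuboidal tensor-product mesh, then $$\|\nabla\mathbf v_h\|_h^2\le\|\nabla\widetilde{\mathbf v}_h\|_h^2 .$$
   Context: Each element $K\in\mathcal T_h$ is the image of the reference element $\hat K=[0,1]^d$ ($d=2$ quadrilaterals, $d=3$ hexahedra) under a bijective geometric mapping $\Phi_K$, each component of which is a polynomial of degree at most $1$ in each variable, with Jacobian matrix $J_K$. $\mathbf S_h^1$ is the space of continuous functions $\mathbf v_h:\overline\Omega\to\mathbb R^3$ such that each component of $(\mathbf v_h|_K)\circ\Phi_K$ is a polynomial on $\hat K$ of degree at most $1$ in each variable, for every $K$. $\mathcal Q_K$ is the set of vertices of $K$, $\mathcal Q$ the set of all mesh vertices, and $I_h$ is nodal interpolation into the finite element space at $\mathcal Q$. With $\hat\omega=2^{-d}$ the weight of the tensor-product two-point Gauss--Lobatto rule on $\hat K$, set $\omega_{K,\mathbf z}=\hat\omega\,|\det J_K(\Phi_K^{-1}(\mathbf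 z))|$ and $$\|\nabla\mathbf v_h\|_h^2=\sum_{K\in\mathcal T_h}\sum_{\mathbf z\in\mathcal Q_K}\omega_{K,\mathbf z}\,|\nabla(\mathbf v_h|_K)(\mathbf z)|^2,$$ with $|\cdot|$ the Frobenius norm for matrices and Euclidean norm for vectors; gradients are taken elementwise. Shape-regularity: with $h_K$ the diameter of $K$ and $h=\max_Kh_K$, there is a constant $\sigma>0$ independent of $h$ with, for all $K$, $\|J_K\|_{L^\infty(\hat K)}\le\sigma h_K$, $\|J_K^{-1}\|_{L^\infty(\hat K)}\le\sigma h_K^{-1}$, $\|\det J_K\|_{L^\infty(\hat K)}\le\sigma h_K^d$, $\|\det(J_K^{-1})\|_{L^\infty(\hat K)}\le\sigma h_K^{-d}$. "Independent of $h$" means that $C_{\mathcal T_h}$ depends only on the shape-regularity (and $d$). A Cartesian rectangular/cuboidal tensor-product mesh is a mesh into boxes $\prod_{i=1}^d[x_{K,i}^-,x_{K,i}^+]$ generated by the tensor product of one-dimensional partitions. *)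

theory Defs
  imports "HOL-Analysis.Analysis"
begin

section \<open>Reference element and element mappings\<close>

definition ref_cube :: "(real^'d) set" where
  "ref_cube = {y. \<forall>i. 0 \<le> y $ i \<and> y $ i \<le> 1}"

definition ref_vertices :: "(real^'d) set" where
  "ref_vertices = {y. \<forall>i. y $ i = 0 \<or> y $ i = 1}"

definition ref_face :: "(real^'d) set \<Rightarrow> bool" where
  "ref_face F \<longleftrightarrow> (\<exists>A. \<exists>b\<in>ref_vertices. F = {y \<in> ref_cube. \<forall>i\<in>A. y $ i = b $ i})"

text \<open>The symmetries of the cube: a permutation of the coordinates combined with reflections
  \<open>t \<mapsto> 1 - t\<close> in some of them, i.e. the admissible renumberings of the vertices.\<close>

definition ref_symmetry :: "(real^'d \<Rightarrow> real^'d) \<Rightarrow> bool" where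
  "ref_symmetry g \<longleftrightarrow>
     (\<exists>\<pi> S. bij \<pi> \<and> g = (\<lambda>y. \<chi> i. if i \<in> S then 1 - y $ (\<pi> i) else y $ (\<pi> i)))"

text \<open>A monomial of degree at most one in each variable is a product over a set of variables.\<close>

definition q1_polynomial :: "(real^'d \<Rightarrow> real) \<Rightarrow> bool" where
  "q1_polynomial p \<longleftrightarrow>
     (\<exists>c :: 'd set \<Rightarrow> real. \<forall>y\<in>ref_cube. p y = (\<Sum>A\<in>UNIV. c A * (\<Prod>i\<in>A. y $ i)))"

text \<open>The Jacobian is taken within the closed cube, hence is also meaningful on its boundary.\<close>

definition elt_jacobian :: "(real^'d \<Rightarrow> real^'d) \<Rightarrow> real^'d \<Rightarrow> real^'d^'d" where
  "elt_jacobian \<phi> y = jacobian \<phi> (at y within ref_cube)"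


section \<open>Meshes\<close>

text \<open>A mesh is a finite set \<open>T\<close> of elements together with the element mappings \<open>\<Phi> K\<close>.
  Conformity is the usual one for mapped elements: two distinct intersecting elements meet in a
  whole common face (vertex, edge, ...), which both mappings parametrise in the same way up to a
  renumbering of the reference vertices.\<close>

definition conforming ::
  "(real^'d) set set \<Rightarrow> ((real^'d) set \<Rightarrow> real^'d \<Rightarrow> real^'d) \<Rightarrow> bool" where
  "conforming T \<Phi> \<longleftrightarrow>
     (\<forall>K\<in>T. \<forall>K'\<in>T. K \<noteq> K' \<longrightarrow> K \<inter> K' \<noteq> {} \<longrightarrow>
        (\<exists>F g. ref_face F \<and> ref_symmetry g \<and> K \<inter> K' = \<Phi> K ` F \<and>
               (\<forall>y\<in>F. \<Phi> K' (g y) = \<Phi> K y)))"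

definition fe_mesh ::
  "(real^'d) set \<Rightarrow> (real^'d) set set \<Rightarrow> ((real^'d) set \<Rightarrow> real^'d \<Rightarrow> real^'d) \<Rightarrow> bool" where
  "fe_mesh \<Omega> T \<Phi> \<longleftrightarrow>
     open \<Omega> \<and> \<Omega> \<noteq> {} \<and> finite T \<and> closure \<Omega> = \<Union>T \<and>
     (\<forall>K\<in>T. bij_betw (\<Phi> K) ref_cube K \<and> (\<forall>i. q1_polynomial (\<lambda>y. \<Phi> K y $ i))) \<and>
     conforming T \<Phi>"

text \<open>Since \<open>J\<^sub>K\<close> is continuous on the closed cube, the bounds in \<open>L\<^sup>\<infinity>\<close> are pointwise
  bounds. The norm on the type of matrices is the Frobenius norm. The
  condition \<open>invertible\<close> is needed because \<open>matrix_inv\<close> is unspecified on singular matrices.\<close>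

definition shape_regular ::
  "real \<Rightarrow> (real^'d) set set \<Rightarrow> ((real^'d) set \<Rightarrow> real^'d \<Rightarrow> real^'d) \<Rightarrow> bool" where
  "shape_regular \<sigma> T \<Phi> \<longleftrightarrow>
     (\<forall>K\<in>T. \<forall>y\<in>ref_cube.
        let J = elt_jacobian (\<Phi> K) y; h = diameter K in
          invertible J \<and>
          norm J \<le> \<sigma> * h \<and>
          norm (matrix_inv J) \<le> \<sigma> / h \<and>
          \<bar>det J\<bar> \<le> \<sigma> * h ^ CARD('d) \<and>
          \<bar>det (matrix_inv J)\<bar> \<le> \<sigma> / h ^ CARD('d))"

text \<open>Two neighbouring nodes of a one-dimensional partition with node set \<open>P\<close>.\<close>

definition consecutive :: "real set \<Rightarrow> real \<Rightarrow> real \<Rightarrow> bool" where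
  "consecutive P a b \<longleftrightarrow> a \<in> P \<and> b \<in> P \<and> a < b \<and> P \<inter> {a<..<b} = {}"

definition cartesian_tensor_product :: "(real^'d) set set \<Rightarrow> bool" where
  "cartesian_tensor_product T \<longleftrightarrow>
     (\<exists>P :: 'd \<Rightarrow> real set. (\<forall>i. finite (P i)) \<and>
        T = {cbox a b | a b. \<forall>i. consecutive (P i) (a $ i) (b $ i)})"

definition elt_vertices ::
  "((real^'d) set \<Rightarrow> real^'d \<Rightarrow> real^'d) \<Rightarrow> (real^'d) set \<Rightarrow> (real^'d) set" where
  "elt_vertices \<Phi> K = \<Phi> K ` ref_vertices"

definition mesh_vertices ::
  "(real^'d) set set \<Rightarrow> ((real^'d) set \<Rightarrow> real^'d \<Rightarrow> real^'d) \<Rightarrow> (real^'d) set" where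
  "mesh_vertices T \<Phi> = (\<Union>K\<in>T. elt_vertices \<Phi> K)"


section \<open>Finite element space, nodal interpolation, discrete seminorm\<close>

text \<open>Functions on the closure of \<open>\<Omega>\<close> are represented as total functions with the fixed value
  \<open>undefined\<close> outside of it.\<close>

definition fe_space ::
  "(real^'d) set \<Rightarrow> (real^'d) set set \<Rightarrow> ((real^'d) set \<Rightarrow> real^'d \<Rightarrow> real^'d) \<Rightarrow> (real^'d \<Rightarrow> real^3) set"
  where
  "fe_space \<Omega> T \<Phi> =
     {v \<in> extensional (closure \<Omega>). continuous_on (closure \<Omega>) v \<and>
        (\<forall>K\<in>T. \<forall>j. q1_polynomial (\<lambda>y. v (\<Phi> K y) $ j))}"

definition nodal_interpolation ::
  "(real^'d) set \<Rightarrow> (real^'d) set set \<Rightarrow> ((real^'d) set \<Rightarrow> real^'d \<Rightarrow> real^'d) \<Rightarrow>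
   (real^'d \<Rightarrow> real^3) \<Rightarrow> real^'d \<Rightarrow> real^3" where
  "nodal_interpolation \<Omega> T \<Phi> f =
     (THE v. v \<in> fe_space \<Omega> T \<Phi> \<and> (\<forall>z\<in>mesh_vertices T \<Phi>. v z = f z))"

definition quad_weight ::
  "((real^'d) set \<Rightarrow> real^'d \<Rightarrow> real^'d) \<Rightarrow> (real^'d) set \<Rightarrow> real^'d \<Rightarrow> real" where
  "quad_weight \<Phi> K z =
     (1 / 2) ^ CARD('d) * \<bar>det (elt_jacobian (\<Phi> K) (inv_into ref_cube (\<Phi> K) z))\<bar>"

text \<open>The elementwise gradient at a vertex \<open>z\<close> of \<open>K\<close> is the (one-sided) derivative of the
  restriction to \<open>K\<close>, i.e. the derivative within \<open>K\<close>; \<open>norm\<close> is again the Frobenius norm.\<close>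

definition discrete_grad_norm_sq ::
  "(real^'d) set set \<Rightarrow> ((real^'d) set \<Rightarrow> real^'d \<Rightarrow> real^'d) \<Rightarrow> (real^'d \<Rightarrow> real^3) \<Rightarrow> real" where
  "discrete_grad_norm_sq T \<Phi> v =
     (\<Sum>K\<in>T. \<Sum>z\<in>elt_vertices \<Phi> K.
        quad_weight \<Phi> K z * (norm (jacobian v (at z within K)))\<^sup>2)"

end

theory Submission
  imports Defs
begin

text \<open>On the reference cube the columns of the gradient of a \<open>Q\<^sub>1\<close> function at a vertex are the
  differences of its nodal values over the edges at that vertex. Outside of the open unit ball
  \<open>a \<mapsto> a / |a|\<close> is a contraction, so normalising the nodal values shrinks every
  column. The physical gradient is the reference one times \<open>J\<^sub>K\<^sup>-\<^sup>1\<close>, which costs at most the factor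
  \<open>(\<parallel>J\<^sub>K\<parallel> \<parallel>J\<^sub>K\<^sup>-\<^sup>1\<parallel>)\<^sup>2 \<le> \<sigma>\<^sup>4\<close>. If \<open>K\<close> is a box, every column
  of \<open>J\<^sub>K\<^sup>-\<^sup>1\<close> at a vertex has a single nonzero entry, so the columns are only permuted and
  rescaled, and nothing is lost.\<close>

section \<open>Lagrange basis of the multilinear polynomials\<close>

text \<open>Vertices are indexed by the set of coordinates equal to 1. Monomials in
  \<open>q1_polynomial\<close> have the same index type, so nodal values and coefficients range over
  one finite type.\<close>

definition vertex :: "'d set \<Rightarrow> real^'d" where
  "vertex S = (\<chi> i. if i \<in> S then 1 else 0)"

definition shape :: "'d::finite set \<Rightarrow> real^'d \<Rightarrow> real" where
  "shape S y = (\<Prod>i\<in>UNIV. if i \<in> S then y $ i else 1 - y $ i)"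

lemma vertex_nth [simp]: "vertex S $ i = (if i \<in> S then 1 else 0)"
  by (simp add: vertex_def)

lemma ref_vertices_eq: "(ref_vertices :: (real^'d) set) = range vertex"
proof
  show "(ref_vertices :: (real^'d) set) \<subseteq> range vertex"
  proof
    fix y :: "real^'d" assume "y \<in> ref_vertices"
    then have "y = vertex {i. y $ i = 1}"
      by (auto simp: ref_vertices_def vec_eq_iff)
    then show "y \<in> range vertex" by blast
  qed
qed (auto simp: ref_vertices_def)

lemma vertex_in_ref_cube [simp]: "vertex S \<in> ref_cube"
  by (simp add: ref_cube_def)

lemma ref_cube_eq_cbox: "ref_cube = cbox 0 1"
  by (auto simp: ref_cube_def mem_box_cart)

lemma shape_vertex: "shape R (vertex S) = (if R = S then 1 else 0)"
proof (cases "R = S")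
  case False
  then obtain i where "i \<in> R \<longleftrightarrow> i \<notin> S" by blast
  then show ?thesis
    using False unfolding shape_def by (auto intro!: prod_zero bexI[of _ i])
qed (auto simp: shape_def intro: prod.neutral)

lemma sum_shape_vertex:
  fixes a :: "'d::finite set \<Rightarrow> 'a::real_vector"
  shows "(\<Sum>R\<in>UNIV. shape R (vertex S) *\<^sub>R a R) = a S"
proof -
  have "(\<Sum>R\<in>UNIV. shape R (vertex S) *\<^sub>R a R) = (\<Sum>R\<in>UNIV. if R = S then a R else 0)"
    by (rule sum.cong) (auto simp: shape_vertex)
  then show ?thesis by simp
qed

text \<open>Multiply by \<open>y $ i + (1 - y $ i) = 1\<close> for i outside \<open>A\<close> and
  expand over subsets \<open>S\<close>. Only the \<open>S\<close> containing \<open>A\<close>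
  survive, and these are exactly the vertices where the monomial equals 1.\<close>

lemma monomial_eq_sum_shape:
  "(\<Prod>i\<in>A. y $ i) = (\<Sum>S\<in>UNIV. shape S y * (\<Prod>i\<in>A. vertex S $ i))"
proof -
  let ?g = "\<lambda>i. if i \<in> A then 0 else 1 - y $ i"
  have "(\<Prod>i\<in>A. y $ i) = (\<Prod>i\<in>UNIV. y $ i + ?g i)"
    by (rule prod.mono_neutral_cong_left) auto
  also have "\<dots> = (\<Sum>S\<in>UNIV. (\<Prod>i\<in>S. y $ i) * (\<Prod>i\<in>-S. ?g i))"
    by (simp add: prod_add Compl_eq_Diff_UNIV)
  also have "\<dots> = (\<Sum>S\<in>UNIV. shape S y * (\<Prod>i\<in>A. vertex S $ i))"
  proof (rule sum.cong[OF refl])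
    fix S :: "'a set"
    show "(\<Prod>i\<in>S. y $ i) * (\<Prod>i\<in>-S. ?g i) = shape S y * (\<Prod>i\<in>A. vertex S $ i)"
    proof (cases "A \<subseteq> S")
      case True
      then have "(\<Prod>i\<in>-S. ?g i) = (\<Prod>i\<in>-S. 1 - y $ i)" "(\<Prod>i\<in>A. vertex S $ i) = 1"
        by (auto intro!: prod.cong prod.neutral)
      moreover have "shape S y = (\<Prod>i\<in>S. y $ i) * (\<Prod>i\<in>-S. 1 - y $ i)"
        by (simp add: shape_def prod.If_cases)
      ultimately show ?thesis by simp
    next
      case False
      then obtain i where "i \<in> A" "i \<notin> S" by blast
      then have "(\<Prod>i\<in>-S. ?g i) = 0" "(\<Prod>i\<in>A. vertex S $ i) = 0"
        by (intro prod_zero; force)+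
      then show ?thesis by (simp only: mult_zero_right)
    qed
  qed
  finally show ?thesis .
qed

text \<open>Forwards, the preceding expansion is applied to each monomial. Backwards, each shape
  function is itself a combination of monomials.\<close>

lemma q1_polynomial_iff:
  "q1_polynomial p \<longleftrightarrow> (\<forall>y\<in>ref_cube. p y = (\<Sum>S\<in>UNIV. shape S y * p (vertex S)))"
proof
  assume "q1_polynomial p"
  then obtain c where c: "\<forall>y\<in>ref_cube. p y = (\<Sum>A\<in>UNIV. c A * (\<Prod>i\<in>A. y $ i))"
    unfolding q1_polynomial_def by blast
  have "(\<Sum>A\<in>UNIV. c A * (\<Prod>i\<in>A. y $ i)) = (\<Sum>S\<in>UNIV. shape S y * p (vertex S))" for y
  proof -
    have "(\<Sum>A\<in>UNIV. c A * (\<Prod>i\<in>A. y $ i))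
        = (\<Sum>A\<in>UNIV. \<Sum>S\<in>UNIV. shape S y * (c A * (\<Prod>i\<in>A. vertex S $ i)))"
      by (subst monomial_eq_sum_shape) (simp only: sum_distrib_left mult.left_commute)
    also have "\<dots> = (\<Sum>S\<in>UNIV. shape S y * p (vertex S))"
      by (subst sum.swap) (simp only: c[rule_format] vertex_in_ref_cube sum_distrib_left)
    finally show ?thesis .
  qed
  with c show "\<forall>y\<in>ref_cube. p y = (\<Sum>S\<in>UNIV. shape S y * p (vertex S))" by simp
next
  assume *: "\<forall>y\<in>ref_cube. p y = (\<Sum>S\<in>UNIV. shape S y * p (vertex S))"
  \<comment> \<open>The coefficient of the monomial over \<open>A\<close> in \<open>shape S\<close>:
    the linear term of the factor at i is taken for i in \<open>A\<close>, its constant term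
    otherwise.\<close>
  define e where "e S A = (\<Prod>i\<in>A. if i \<in> S then 1 else -1) * (\<Prod>i\<in>-A. if i \<in> S then 0 else 1 :: real)"
    for S A :: "'a set"
  have "shape S y = (\<Sum>A\<in>UNIV. e S A * (\<Prod>i\<in>A. y $ i))" for S y
  proof -
    have "shape S y = (\<Prod>i\<in>UNIV. (if i \<in> S then 1 else -1) * y $ i + (if i \<in> S then 0 else 1))"
      unfolding shape_def by (rule prod.cong) auto
    then show ?thesis
      by (simp add: prod_add Compl_eq_Diff_UNIV e_def prod.distrib mult_ac)
  qed
  then have "p y = (\<Sum>A\<in>UNIV. (\<Sum>S\<in>UNIV. e S A * p (vertex S)) * (\<Prod>i\<in>A. y $ i))"
    if "y \<in> ref_cube" for y
    unfolding *[rule_format, OF that]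
    by (simp only: sum_distrib_left sum_distrib_right mult_ac) (rule sum.swap)
  then show "q1_polynomial p"
    unfolding q1_polynomial_def by (intro exI[of _ "\<lambda>A. \<Sum>S\<in>UNIV. e S A * p (vertex S)"] ballI)
qed

definition q1_map :: "(real^'d \<Rightarrow> 'a::real_vector) \<Rightarrow> bool" where
  "q1_map f \<longleftrightarrow> (\<forall>y\<in>ref_cube. f y = (\<Sum>S\<in>UNIV. shape S y *\<^sub>R f (vertex S)))"

lemma q1_map_iff_components:
  "q1_map f \<longleftrightarrow> (\<forall>j. q1_polynomial (\<lambda>y. f y $ j))"
  unfolding q1_map_def q1_polynomial_iff vec_eq_iff sum_component vector_scaleR_component real_scaleR_def
  by blast

section \<open>Derivatives at the vertices\<close>

text \<open>Along an edge a \<open>Q\<^sub>1\<close> map is affine, so the columns of its Jacobian at a vertex are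
  the differences over the edges meeting there.\<close>

definition edge_diff :: "(real^'d \<Rightarrow> real^'m) \<Rightarrow> 'd set \<Rightarrow> real^'d^'m" where
  "edge_diff f S = (\<chi> j k. (f (vertex (insert k S)) - f (vertex (S - {k}))) $ j)"

lemma column_edge_diff:
  "column k (edge_diff f S) = f (vertex (insert k S)) - f (vertex (S - {k}))"
  by (simp add: column_def edge_diff_def vec_eq_iff)

text \<open>By the product rule the partial derivative in direction k is, up to sign, the product of
  the other factors at \<open>vertex S\<close>. It vanishes as soon as \<open>R\<close> and
  \<open>S\<close> differ in a coordinate other than k.\<close>

lemma shape_has_derivative:
  fixes R S :: "'d::finite set"
  shows "(shape R has_derivative
     (\<lambda>h. \<Sum>k\<in>UNIV. if R - {k} = S - {k} then (if k \<in> R then h $ k else - h $ k) else 0))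
   (at (vertex S) within X)"
proof -
  let ?f = "\<lambda>i y. if i \<in> R then y $ i else 1 - y $ i"
  have d: "(?f i has_derivative (\<lambda>h. if i \<in> R then h $ i else - h $ i)) (at (vertex S) within X)" for i
    by (cases "i \<in> R")
       (auto intro!: derivative_eq_intros bounded_linear.has_derivative[OF bounded_linear_vec_nth])
  have p: "(\<Prod>j\<in>UNIV - {k}. ?f j (vertex S)) = (if R - {k} = S - {k} then 1 else 0)" for k
  proof (cases "R - {k} = S - {k}")
    case False
    then obtain i where "i \<noteq> k" "i \<in> R \<longleftrightarrow> i \<notin> S" by blast
    with False show ?thesis
      by (auto intro!: prod_zero bexI[of _ i])
  next
    case True
    then have "j \<in> R \<longleftrightarrow> j \<in> S" if "j \<noteq> k" for j using that by blast
    then have "(\<Prod>j\<in>UNIV - {k}. ?f j (vertex S)) = 1" by (intro prod.neutral) simp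
    with True show ?thesis by (simp only: refl if_True)
  qed
  have "shape R = (\<lambda>y. \<Prod>i\<in>UNIV. ?f i y)"
    by (simp add: shape_def fun_eq_iff)
  moreover have "((\<lambda>y. \<Prod>i\<in>UNIV. ?f i y) has_derivative
      (\<lambda>h. \<Sum>k\<in>UNIV. (if k \<in> R then h $ k else - h $ k) * (if R - {k} = S - {k} then 1 else 0)))
      (at (vertex S) within X)"
    using has_derivative_prod[where I = UNIV and f = ?f, OF d] unfolding p .
  moreover have "(if k \<in> R then h $ k else - h $ k) * (if R - {k} = S - {k} then 1 else 0)
      = (if R - {k} = S - {k} then (if k \<in> R then h $ k else - h $ k) else 0)" for h :: "real^'d" and k
    by simp
  ultimately show ?thesis by (simp only:)
qed

text \<open>In direction k only the two ends of the edge, \<open>insert k S\<close> and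
  \<open>S - {k}\<close>, contribute, with opposite signs.\<close>

lemma q1_map_has_derivative:
  fixes f :: "real^'d \<Rightarrow> real^'m"
  assumes "q1_map f"
  shows "(f has_derivative (\<lambda>h. edge_diff f S *v h)) (at (vertex S) within ref_cube)"
proof -
  have "((\<lambda>y. \<Sum>R\<in>UNIV. shape R y *\<^sub>R f (vertex R)) has_derivative (\<lambda>h. \<Sum>R\<in>UNIV.
      (\<Sum>k\<in>UNIV. if R - {k} = S - {k} then (if k \<in> R then h $ k else - h $ k) else 0) *\<^sub>R f (vertex R)))
      (at (vertex S) within ref_cube)"
    by (intro has_derivative_sum has_derivative_scaleR_left shape_has_derivative)
  moreover have "(\<Sum>R\<in>UNIV.
      (\<Sum>k\<in>UNIV. if R - {k} = S - {k} then (if k \<in> R then h $ k else - h $ k) else 0) *\<^sub>R f (vertex R))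
      = edge_diff f S *v h" for h
  proof -
    have "(\<Sum>R\<in>UNIV. if R - {k} = S - {k} then (if k \<in> R then h $ k else - h $ k) *\<^sub>R f (vertex R) else 0)
        = h $ k *\<^sub>R column k (edge_diff f S)" (is "?l = _") for k
    proof -
      have "?l = (\<Sum>R\<in>{insert k S, S - {k}}. if R - {k} = S - {k} then (if k \<in> R then h $ k else - h $ k) *\<^sub>R f (vertex R) else 0)"
        by (rule sum.mono_neutral_cong_right) auto
      also have "\<dots> = h $ k *\<^sub>R column k (edge_diff f S)"
      proof -
        have "insert k S \<noteq> S - {k}" by blast
        then show ?thesis by (simp add: column_edge_diff algebra_simps)
      qed
      finally show ?thesis .
    qed
    note col = this
    have "(\<Sum>R\<in>UNIV.
      (\<Sum>k\<in>UNIV. if R - {k} = S - {k} then (if k \<in> R then h $ k else - h $ k) else 0) *\<^sub>R f (vertex R))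
      = (\<Sum>k\<in>UNIV. \<Sum>R\<in>UNIV. if R - {k} = S - {k} then (if k \<in> R then h $ k else - h $ k) *\<^sub>R f (vertex R) else 0)"
      unfolding scaleR_sum_left
      by (subst sum.swap) (intro sum.cong refl, simp)
    also have "\<dots> = edge_diff f S *v h"
      unfolding col by (simp add: matrix_mult_sum scalar_mult_eq_scaleR)
    finally show ?thesis .
  qed
  ultimately have "((\<lambda>y. \<Sum>R\<in>UNIV. shape R y *\<^sub>R f (vertex R)) has_derivative (\<lambda>h. edge_diff f S *v h))
      (at (vertex S) within ref_cube)"
    by simp
  moreover have "f y = (\<Sum>R\<in>UNIV. shape R y *\<^sub>R f (vertex R))" if "y \<in> ref_cube" for y
    using assms that unfolding q1_map_def by blast
  ultimately show ?thesis
    by (rule has_derivative_transform[OF vertex_in_ref_cube, rotated])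
qed

text \<open>Derivatives within a set may fail to be unique at a boundary point. The cube is a
  nondegenerate box, so every axis offers a feasible direction and uniqueness holds.\<close>

lemma matrix_eq_of_derivative_within_ref_cube:
  fixes A B :: "real^'d^'m"
  assumes "(f has_derivative (\<lambda>h. A *v h)) (at y within ref_cube)"
    and "(f has_derivative (\<lambda>h. B *v h)) (at y within ref_cube)"
    and "y \<in> ref_cube"
  shows "A = B"
proof -
  have "(\<lambda>h. A *v h) = (\<lambda>h. B *v h)"
    using assms unfolding ref_cube_eq_cbox
    by (intro frechet_derivative_unique_within_closed_interval[of 0 1])
       (auto simp: Basis_vec_def inner_axis)
  then show ?thesis by (metis matrix_eq)
qed

lemma elt_jacobian_vertex:
  assumes "q1_map \<phi>"
  shows "elt_jacobian \<phi> (vertex S) = edge_diff \<phi> S"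
  unfolding elt_jacobian_def
  using q1_map_has_derivative[OF assms, of S]
  by (intro matrix_eq_of_derivative_within_ref_cube[where f = \<phi> and y = "vertex S"])
     (auto simp: jacobian_works[symmetric] intro: differentiableI)

text \<open>The image of \<open>S\<close> need not be a neighbourhood of \<open>f x\<close>, so the
  remainder is estimated directly: \<open>g'\<close> turns the remainder of \<open>f\<close> into
  that of \<open>g\<close>, and continuity of \<open>g\<close> ensures that nearby images have
  nearby preimages.\<close>

lemma has_derivative_inverse_within:
  fixes f :: "'a::real_normed_vector \<Rightarrow> 'b::real_normed_vector"
  assumes f: "(f has_derivative f') (at x within S)"
    and g': "bounded_linear g'" and id: "g' \<circ> f' = id"
    and cont: "continuous (at (f x) within f ` S) g"
    and gf: "\<And>y. y \<in> S \<Longrightarrow> g (f y) = y" and x: "x \<in> S"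
  shows "(g has_derivative g') (at (f x) within f ` S)"
  unfolding has_derivative_within_alt
proof (intro conjI allI impI)
  show "bounded_linear g'" by fact
  interpret g': bounded_linear g' by fact
  obtain C where C: "0 < C" "\<And>x. norm (g' x) \<le> norm x * C"
    using g'.pos_bounded by blast
  have near: "\<exists>d>0. \<forall>y\<in>S. norm (f y - f x) < d \<longrightarrow>
      norm (y - x - g' (f y - f x)) \<le> e * norm (y - x)" if "e > 0" for e
  proof -
    have "e / C > 0" using that C by simp
    then obtain d0 where d0: "d0 > 0"
      "\<And>y. y \<in> S \<Longrightarrow> norm (y - x) < d0 \<Longrightarrow> norm (f y - f x - f' (y - x)) \<le> e / C * norm (y - x)"
      using f unfolding has_derivative_within_alt by meson
    obtain d where d: "d > 0" "\<And>z. z \<in> f ` S \<Longrightarrow> dist z (f x) < d \<Longrightarrow> dist (g z) (g (f x)) < d0"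
      using cont d0(1) unfolding continuous_within_eps_delta by meson
    show ?thesis
    proof (intro exI[of _ d] conjI ballI impI d(1))
      fix y assume y: "y \<in> S" "norm (f y - f x) < d"
      have "norm (y - x) < d0"
        using d(2)[of "f y"] y gf x by (simp add: dist_norm)
      have "g' (f' u) = u" for u using id by (metis comp_apply id_apply)
      then have "norm (y - x - g' (f y - f x)) = norm (g' (f y - f x - f' (y - x)))"
        by (simp add: g'.diff norm_minus_commute)
      also have "\<dots> \<le> norm (f y - f x - f' (y - x)) * C" by (rule C)
      also have "\<dots> \<le> (e / C * norm (y - x)) * C"
        using d0(2)[OF y(1) \<open>norm (y - x) < d0\<close>] C(1) by (intro mult_right_mono) auto
      finally show "norm (y - x - g' (f y - f x)) \<le> e * norm (y - x)" using C(1) by simp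
    qed
  qed
  \<comment> \<open>The factor 1/2 lets the remainder be absorbed and yields
    \<open>norm (y - x) \<le> 2 * C * norm (f y - f x)\<close>, which is why the second estimate
    uses \<open>e / (2 * C)\<close>.\<close>
  obtain d1 where d1: "d1 > 0"
    "\<And>y. y \<in> S \<Longrightarrow> norm (f y - f x) < d1 \<Longrightarrow> norm (y - x - g' (f y - f x)) \<le> 1/2 * norm (y - x)"
    using near[of "1/2"] by auto
  fix e :: real assume "0 < e"
  then have "e / (2 * C) > 0" using C by simp
  then obtain d2 where d2: "d2 > 0"
    "\<And>y. y \<in> S \<Longrightarrow> norm (f y - f x) < d2 \<Longrightarrow> norm (y - x - g' (f y - f x)) \<le> e / (2 * C) * norm (y - x)"
    using near by meson
  show "\<exists>d>0. \<forall>z\<in>f ` S. norm (z - f x) < d \<longrightarrow> norm (g z - g (f x) - g' (z - f x)) \<le> e * norm (z - f x)"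
  proof (intro exI[of _ "min d1 d2"] conjI ballI impI)
    fix z assume "z \<in> f ` S" and z: "norm (z - f x) < min d1 d2"
    then obtain y where y: "y \<in> S" "z = f y" by blast
    have "norm (y - x) \<le> norm (g' (f y - f x)) + norm (y - x - g' (f y - f x))"
      using norm_triangle_ineq[of "g' (f y - f x)" "y - x - g' (f y - f x)"] by simp
    also have "\<dots> \<le> norm (f y - f x) * C + 1/2 * norm (y - x)"
      using C(2) d1(2)[OF y(1)] z y by (intro add_mono) auto
    finally have "norm (y - x) \<le> 2 * C * norm (f y - f x)" by (simp add: mult_ac)
    then have "e / (2 * C) * norm (y - x) \<le> e / (2 * C) * (2 * C * norm (f y - f x))"
      using \<open>e / (2 * C) > 0\<close> by (intro mult_left_mono) auto
    with d2(2)[OF y(1)] z y C(1) have "norm (y - x - g' (f y - f x)) \<le> e * norm (f y - f x)"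
      by auto
    then show "norm (g z - g (f x) - g' (z - f x)) \<le> e * norm (z - f x)"
      using y x gf by simp
  qed (use d1 d2 in auto)
qed

section \<open>The inverse element mapping and gradients on a mapped element\<close>

lemma matrix_inv_both:
  fixes A :: "real^'n^'n"
  assumes "invertible A"
  shows "A ** matrix_inv A = mat 1" "matrix_inv A ** A = mat 1"
proof -
  have "A ** matrix_inv A = mat 1 \<and> matrix_inv A ** A = mat 1"
    using assms unfolding invertible_def matrix_inv_def by (rule someI_ex)
  then show "A ** matrix_inv A = mat 1" "matrix_inv A ** A = mat 1" by auto
qed

lemma q1_map_continuous_on:
  fixes f :: "real^'d \<Rightarrow> 'a::real_normed_vector"
  assumes "q1_map f"
  shows "continuous_on ref_cube f"
proof -
  have "continuous_on ref_cube (\<lambda>y. if i \<in> S then y $ i else 1 - y $ i)"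
    for i and S :: "'d set"
    by (cases "i \<in> S") (auto intro!: continuous_intros)
  then have "continuous_on ref_cube (shape S)" for S :: "'d set"
    unfolding shape_def[abs_def] by (intro continuous_on_prod)
  then have "continuous_on ref_cube (\<lambda>y. \<Sum>S\<in>UNIV. shape S y *\<^sub>R f (vertex S))"
    by (intro continuous_intros)
  then show ?thesis
    using assms unfolding q1_map_def by (simp cong: continuous_on_cong)
qed

lemma compact_ref_cube: "compact ref_cube"
  by (simp add: ref_cube_eq_cbox compact_cbox)

lemma continuous_on_inv_elt_map:
  fixes \<phi> :: "real^'d \<Rightarrow> real^'m"
  assumes "q1_map \<phi>" "bij_betw \<phi> ref_cube K"
  shows "continuous_on K (inv_into ref_cube \<phi>)"
  using continuous_on_inv[OF q1_map_continuous_on[OF assms(1)] compact_ref_cube, of "inv_into ref_cube \<phi>"]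
    bij_betw_inv_into_left[OF assms(2)] assms(2)
  by (simp add: bij_betw_def)

lemma inv_elt_map_has_derivative:
  fixes \<phi> :: "real^'d \<Rightarrow> real^'d"
  assumes \<phi>: "q1_map \<phi>" "bij_betw \<phi> ref_cube K" and "invertible (edge_diff \<phi> S)"
  shows "(inv_into ref_cube \<phi> has_derivative (\<lambda>h. matrix_inv (edge_diff \<phi> S) *v h))
           (at (\<phi> (vertex S)) within K)"
proof -
  have K: "K = \<phi> ` ref_cube" using \<phi>(2) by (simp add: bij_betw_def)
  have "(inv_into ref_cube \<phi> has_derivative (\<lambda>h. matrix_inv (edge_diff \<phi> S) *v h))
           (at (\<phi> (vertex S)) within \<phi> ` ref_cube)"
  proof (rule has_derivative_inverse_within)
    show "(\<phi> has_derivative (\<lambda>h. edge_diff \<phi> S *v h)) (at (vertex S) within ref_cube)"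
      by (rule q1_map_has_derivative[OF \<phi>(1)])
    show "bounded_linear (\<lambda>h. matrix_inv (edge_diff \<phi> S) *v h)"
      by (rule matrix_vector_mul_bounded_linear)
    show "(\<lambda>h. matrix_inv (edge_diff \<phi> S) *v h) \<circ> (\<lambda>h. edge_diff \<phi> S *v h) = id"
      using assms(3) by (simp add: fun_eq_iff matrix_vector_mul_assoc matrix_inv_both)
    show "continuous (at (\<phi> (vertex S)) within \<phi> ` ref_cube) (inv_into ref_cube \<phi>)"
      using continuous_on_inv_elt_map[OF \<phi>] unfolding K continuous_on_eq_continuous_within
      by auto
    show "inv_into ref_cube \<phi> (\<phi> y) = y" if "y \<in> ref_cube" for y
      using bij_betw_inv_into_left[OF \<phi>(2) that] .
  qed simp
  then show ?thesis by (simp add: K)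
qed

text \<open>The chain rule through the inverse mapping gives differentiability of \<open>v\<close>
  within \<open>K\<close>. The matrix is then identified by pulling back through
  \<open>\<phi>\<close> to the cube, where derivatives are unique.\<close>

lemma jacobian_at_vertex:
  fixes \<phi> :: "real^'d \<Rightarrow> real^'d"
  assumes \<phi>: "q1_map \<phi>" "bij_betw \<phi> ref_cube K" and inv: "invertible (edge_diff \<phi> S)"
    and v: "q1_map (v \<circ> \<phi>)"
  shows "jacobian v (at (\<phi> (vertex S)) within K) = edge_diff (v \<circ> \<phi>) S ** matrix_inv (edge_diff \<phi> S)"
proof -
  let ?\<psi> = "inv_into ref_cube \<phi>" and ?z = "\<phi> (vertex S)"
  have K: "K = \<phi> ` ref_cube" using \<phi>(2) by (simp add: bij_betw_def)
  have \<psi>z: "?\<psi> ?z = vertex S"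
    using bij_betw_inv_into_left[OF \<phi>(2)] by simp
  have \<psi>K: "?\<psi> ` K = ref_cube"
    using bij_betw_inv_into[OF \<phi>(2)] by (simp add: bij_betw_def)
  have "((v \<circ> \<phi>) \<circ> ?\<psi> has_derivative (\<lambda>h. edge_diff (v \<circ> \<phi>) S *v h) \<circ> (\<lambda>h. matrix_inv (edge_diff \<phi> S) *v h))
      (at ?z within K)"
    using q1_map_has_derivative[OF v, of S]
    by (intro diff_chain_within inv_elt_map_has_derivative[OF \<phi> inv]) (simp add: \<psi>z \<psi>K)
  then have "(v has_derivative (\<lambda>h. edge_diff (v \<circ> \<phi>) S *v h) \<circ> (\<lambda>h. matrix_inv (edge_diff \<phi> S) *v h))
      (at ?z within K)"
    by (rule has_derivative_transform[rotated 2])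
      (use bij_betw_inv_into_right[OF \<phi>(2)] K in auto)
  then have "v differentiable (at ?z within K)" by (rule differentiableI)
  then have "(v has_derivative (\<lambda>h. jacobian v (at ?z within K) *v h)) (at ?z within K)"
    by (simp only: jacobian_works)
  then have "(v \<circ> \<phi> has_derivative (\<lambda>h. jacobian v (at ?z within K) *v h) \<circ> (\<lambda>h. edge_diff \<phi> S *v h))
      (at (vertex S) within ref_cube)"
    unfolding K by (intro diff_chain_within q1_map_has_derivative[OF \<phi>(1)])
  then have "jacobian v (at ?z within K) ** edge_diff \<phi> S = edge_diff (v \<circ> \<phi>) S"
    by (intro matrix_eq_of_derivative_within_ref_cube[OF _ q1_map_has_derivative[OF v]])
       (simp_all add: o_def matrix_vector_mul_assoc)
  then have "edge_diff (v \<circ> \<phi>) S ** matrix_inv (edge_diff \<phi> S)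
      = jacobian v (at ?z within K) ** (edge_diff \<phi> S ** matrix_inv (edge_diff \<phi> S))"
    by (simp add: matrix_mul_assoc)
  then show ?thesis using inv by (simp add: matrix_inv_both)
qed

section \<open>Frobenius norm\<close>

lemma norm_vec_sq:
  fixes x :: "'a::real_inner^'n"
  shows "(norm x)\<^sup>2 = (\<Sum>i\<in>UNIV. (norm (x $ i))\<^sup>2)"
  by (simp add: power2_norm_eq_inner inner_vec_def)

lemma norm_matrix_sq_columns:
  fixes A :: "real^'n^'m"
  shows "(norm A)\<^sup>2 = (\<Sum>j\<in>UNIV. (norm (column j A))\<^sup>2)"
proof -
  have "(norm A)\<^sup>2 = (\<Sum>i\<in>UNIV. \<Sum>j\<in>UNIV. (A $ i $ j)\<^sup>2)"
    by (simp add: norm_vec_sq)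
  also have "\<dots> = (\<Sum>j\<in>UNIV. \<Sum>i\<in>UNIV. (A $ i $ j)\<^sup>2)"
    by (rule sum.swap)
  also have "\<dots> = (\<Sum>j\<in>UNIV. (norm (column j A))\<^sup>2)"
    by (simp add: norm_vec_sq column_def)
  finally show ?thesis .
qed

lemma norm_le_columnwise:
  fixes A B :: "real^'n^'m"
  assumes "\<And>j. norm (column j A) \<le> norm (column j B)"
  shows "norm A \<le> norm B"
proof -
  have "(norm A)\<^sup>2 \<le> (norm B)\<^sup>2"
    unfolding norm_matrix_sq_columns using assms by (intro sum_mono power_mono) auto
  then show ?thesis by (simp add: power2_le_iff_abs_le)
qed

lemma column_matrix_mult: "column j (A ** B) = A *v column j B"
  by (simp add: column_def matrix_matrix_mult_def matrix_vector_mult_def vec_eq_iff)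

lemma norm_matrix_vector_mult_le:
  fixes A :: "real^'n^'m"
  shows "norm (A *v x) \<le> norm A * norm x"
proof -
  have "(norm (A *v x))\<^sup>2 = (\<Sum>i\<in>UNIV. (A $ i \<bullet> x)\<^sup>2)"
    unfolding norm_vec_sq[of "A *v x"] by (simp add: matrix_mult_dot)
  also have "\<dots> \<le> (\<Sum>i\<in>UNIV. (norm (A $ i))\<^sup>2 * (norm x)\<^sup>2)"
  proof (rule sum_mono)
    fix i
    show "(A $ i \<bullet> x)\<^sup>2 \<le> (norm (A $ i))\<^sup>2 * (norm x)\<^sup>2"
      using Cauchy_Schwarz_ineq2[of "A $ i" x]
      by (metis abs_ge_zero power2_abs power_mono power_mult_distrib)
  qed
  also have "\<dots> = (norm A * norm x)\<^sup>2"
    by (simp add: norm_vec_sq[of A] sum_distrib_right power_mult_distrib)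
  finally show ?thesis by (simp add: power2_le_iff_abs_le)
qed

lemma norm_matrix_mult_le:
  fixes A :: "real^'n^'m" and B :: "real^'k^'n"
  shows "norm (A ** B) \<le> norm A * norm B"
proof -
  have "(norm (A ** B))\<^sup>2 \<le> (\<Sum>j\<in>UNIV. (norm A * norm (column j B))\<^sup>2)"
    unfolding norm_matrix_sq_columns[of "A ** B"] column_matrix_mult
    by (intro sum_mono power_mono norm_matrix_vector_mult_le) auto
  also have "\<dots> = (norm A * norm B)\<^sup>2"
    by (simp add: power_mult_distrib norm_matrix_sq_columns[of B] sum_distrib_left)
  finally show ?thesis by (simp add: power2_le_iff_abs_le)
qed

text \<open>A column of \<open>M\<close> with a single nonzero entry merely selects and rescales one
  column of the left factor, so a columnwise comparison survives the multiplication.\<close>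

lemma norm_mult_le_monomial:
  fixes A B :: "real^'n^'m" and M :: "real^'k^'n"
  assumes le: "\<And>j. norm (column j A) \<le> norm (column j B)"
    and M: "\<And>j k k'. M $ k $ j \<noteq> 0 \<Longrightarrow> M $ k' $ j \<noteq> 0 \<Longrightarrow> k = k'"
  shows "norm (A ** M) \<le> norm (B ** M)"
proof (rule norm_le_columnwise)
  fix j
  \<comment> \<open>If column j of \<open>M\<close> vanishes, any k serves.\<close>
  obtain k where k: "\<And>k'. k' \<noteq> k \<Longrightarrow> M $ k' $ j = 0" using M by metis
  have "column j (C ** M) = M $ k $ j *\<^sub>R column k C" for C :: "real^'n^'m"
  proof -
    have "column j (C ** M) = (\<Sum>i\<in>UNIV. M $ i $ j *\<^sub>R column i C)"
      by (simp add: column_matrix_mult matrix_mult_sum scalar_mult_eq_scaleR column_def[of j M])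
    also have "\<dots> = (\<Sum>i\<in>{k}. M $ i $ j *\<^sub>R column i C)"
      using k by (intro sum.mono_neutral_right) auto
    finally show ?thesis by simp
  qed
  then show "norm (column j (A ** M)) \<le> norm (column j (B ** M))"
    by (simp add: le mult_left_mono)
qed

section \<open>Elements that are boxes\<close>

text \<open>Difference quotients at a minimum point are nonnegative along the ray, hence so is their
  one-sided limit. This is meant for the coordinates of the inverse mapping at the image of a
  vertex, where each takes its extreme value 0 or 1.\<close>

lemma has_derivative_within_ray_nonneg:
  fixes f :: "'a::real_normed_vector \<Rightarrow> real"
  assumes f: "(f has_derivative f') (at z within K)" and "\<epsilon> > 0"
    and K: "\<And>t. 0 \<le> t \<Longrightarrow> t \<le> \<epsilon> \<Longrightarrow> z + t *\<^sub>R e \<in> K"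
    and le: "\<And>x. x \<in> K \<Longrightarrow> f z \<le> f x"
  shows "f' e \<ge> 0"
proof -
  let ?g = "\<lambda>t. f (z + t *\<^sub>R e)"
  have "((\<lambda>t. z + t *\<^sub>R e) has_derivative (\<lambda>t. t *\<^sub>R e)) (at 0 within {0..\<epsilon>})"
    by (auto intro!: derivative_eq_intros)
  moreover have "(f has_derivative f') (at (z + 0 *\<^sub>R e) within (\<lambda>t. z + t *\<^sub>R e) ` {0..\<epsilon>})"
    using f K by (auto intro: has_derivative_subset)
  ultimately have "(f \<circ> (\<lambda>t. z + t *\<^sub>R e) has_derivative f' \<circ> (\<lambda>t. t *\<^sub>R e)) (at 0 within {0..\<epsilon>})"
    by (rule diff_chain_within)
  moreover have "f' \<circ> (\<lambda>t. t *\<^sub>R e) = (\<lambda>t. t * f' e)"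
    using has_derivative_linear[OF f] by (simp add: fun_eq_iff linear_scale)
  ultimately have "(?g has_field_derivative f' e) (at_right 0)"
    using \<open>\<epsilon> > 0\<close> by (simp add: o_def has_field_derivative_def mult_commute_abs at_within_Icc_at_right)
  then have "((\<lambda>t. (?g t - ?g 0) / (t - 0)) \<longlongrightarrow> f' e) (at_right 0)"
    by (simp only: has_field_derivative_iff)
  moreover have "\<forall>\<^sub>F t in at_right 0. 0 \<le> (?g t - ?g 0) / (t - 0)"
    unfolding eventually_at_right_field using \<open>\<epsilon> > 0\<close> K le
    by (intro exI[of _ \<epsilon>]) auto
  ultimately show ?thesis
    by (intro tendsto_lowerbound) auto
qed

text \<open>The derivative at a vertex maps the tangent cone of the cube, an orthant, onto the tangent
  cone of the box. The latter is therefore pointed, i.e. an orthant as well, and a linear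
  isomorphism between orthants is monomial.\<close>

lemma matrix_inv_jacobian_box_monomial:
  fixes \<phi> :: "real^'d \<Rightarrow> real^'d"
  assumes \<phi>: "q1_map \<phi>" "bij_betw \<phi> ref_cube (cbox a b)" and inv: "invertible (edge_diff \<phi> S)"
    and ab: "\<And>i. a $ i < b $ i"
    and nz: "matrix_inv (edge_diff \<phi> S) $ k $ j \<noteq> 0" "matrix_inv (edge_diff \<phi> S) $ k' $ j \<noteq> 0"
  shows "k = k'"
proof (rule ccontr)
  assume "k \<noteq> k'"
  define J where "J = edge_diff \<phi> S"
  define M where "M = matrix_inv J"
  have JM: "J ** M = mat 1" and MJ: "M ** J = mat 1"
    using matrix_inv_both[OF inv] by (simp_all add: J_def M_def)
  define z where "z = \<phi> (vertex S)"
  \<comment> \<open>The sign pointing from \<open>vertex S\<close> into the cube along axis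
    i.\<close>
  define c :: "'d \<Rightarrow> real" where "c i = (if i \<in> S then -1 else 1)" for i
  let ?\<psi> = "inv_into ref_cube \<phi>"
  have \<phi>_box: "\<phi> (vertex R) \<in> cbox a b" for R
    using \<phi>(2) by (auto simp: bij_betw_def)
  then have z: "a $ i \<le> z $ i" "z $ i \<le> b $ i" for i
    by (auto simp: z_def mem_box_cart)
  have \<psi>z: "?\<psi> z = vertex S"
    unfolding z_def using bij_betw_inv_into_left[OF \<phi>(2)] by simp
  \<comment> \<open>Up to the sign \<open>c i\<close>, each reference coordinate is minimal at
    \<open>vertex S\<close>, so its derivative is nonnegative in every direction leading from z into
    the box.\<close>
  have cone: "0 \<le> c i * (M *v e) $ i" if e: "z + e \<in> cbox a b" for e i
  proof (rule has_derivative_within_ray_nonneg[where f = "\<lambda>x. c i * ?\<psi> x $ i" and \<epsilon> = 1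
      and f' = "\<lambda>h. c i * (M *v h) $ i" and z = z and K = "cbox a b"])
    have "(?\<psi> has_derivative (\<lambda>h. M *v h)) (at z within cbox a b)"
      unfolding z_def M_def J_def by (rule inv_elt_map_has_derivative[OF \<phi> inv])
    from bounded_linear.has_derivative[OF bounded_linear_vec_nth this]
    show "((\<lambda>x. c i * ?\<psi> x $ i) has_derivative (\<lambda>h. c i * (M *v h) $ i)) (at z within cbox a b)"
      by (rule has_derivative_mult_right)
    show "z + t *\<^sub>R e \<in> cbox a b" if "0 \<le> t" "t \<le> 1" for t
    proof -
      have "(1 - t) *\<^sub>R z + t *\<^sub>R (z + e) \<in> cbox a b"
        using that e z by (intro convexD[OF convex_box(1)]) (auto simp: mem_box_cart)
      then show ?thesis by (simp add: algebra_simps)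
    qed
    fix x assume "x \<in> cbox a b"
    then have "?\<psi> x \<in> ref_cube"
      using bij_betwE[OF bij_betw_inv_into[OF \<phi>(2)]] by blast
    then have "0 \<le> ?\<psi> x $ i" "?\<psi> x $ i \<le> 1" by (simp_all add: ref_cube_def)
    then show "c i * ?\<psi> z $ i \<le> c i * ?\<psi> x $ i"
      by (simp add: \<psi>z c_def)
  qed simp
  \<comment> \<open>The sign pointing from z into the box along axis m, once z is known to be a
    corner.\<close>
  define s :: "'d \<Rightarrow> real" where "s m = (if z $ m = a $ m then 1 else -1)" for m
  have move: "z + t *\<^sub>R axis m 1 \<in> cbox a b" if "a $ m \<le> z $ m + t" "z $ m + t \<le> b $ m" for m t
    using that z by (auto simp: mem_box_cart axis_def)
  have M_axis: "(M *v (t *\<^sub>R axis m 1)) $ i = t * M $ i $ m" for m t i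
    by (simp add: matrix_vector_mult_scaleR matrix_vector_mult_basis column_def)
  \<comment> \<open>Strictly between the two faces, both directions along axis m would be feasible,
    forcing column m of \<open>M\<close> to vanish and contradicting
    \<open>J ** M = mat 1\<close>.\<close>
  have corner: "z $ m = a $ m \<or> z $ m = b $ m" for m
  proof (rule ccontr)
    assume "\<not> ?thesis"
    with z[of m] have lt: "a $ m < z $ m" "z $ m < b $ m" by auto
    have "M $ i $ m = 0" for i
    proof -
      have "0 \<le> c i * ((b $ m - z $ m) * M $ i $ m)" "0 \<le> c i * ((a $ m - z $ m) * M $ i $ m)"
        using cone[OF move, of m "b $ m - z $ m" i] cone[OF move, of m "a $ m - z $ m" i] ab[of m]
        unfolding M_axis by simp_all
      moreover have "c i = 1 \<or> c i = -1" by (simp add: c_def)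
      ultimately show ?thesis
        using lt by (auto simp: zero_le_mult_iff mult_le_0_iff)
    qed
    then have "(J ** M) $ m $ m = 0" by (simp add: matrix_matrix_mult_def)
    then show False by (simp add: JM mat_def)
  qed
  have M_sign: "0 \<le> c i * s m * M $ i $ m" for i m
  proof -
    have "a $ m \<le> z $ m + s m * (b $ m - a $ m)" "z $ m + s m * (b $ m - a $ m) \<le> b $ m"
      using corner[of m] ab[of m] by (auto simp: s_def)
    from cone[OF move[OF this], of i] have "0 \<le> (b $ m - a $ m) * (c i * s m * M $ i $ m)"
      unfolding M_axis by (simp add: mult_ac)
    then show ?thesis using ab[of m] by (simp add: zero_le_mult_iff)
  qed
  have box_sign: "0 \<le> s m * (x $ m - z $ m)" if "x \<in> cbox a b" for x m
    using that corner[of m] by (auto simp: s_def mem_box_cart)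
  \<comment> \<open>Up to the sign \<open>c i\<close>, column i of \<open>J\<close> is the vector
    from z to a neighbouring image vertex, which lies in the box.\<close>
  have J_sign: "0 \<le> c i * s m * J $ m $ i" for i m
  proof (cases "i \<in> S")
    case True
    then have "insert i S = S" by blast
    then have "J $ m $ i = z $ m - \<phi> (vertex (S - {i})) $ m"
      by (simp add: J_def edge_diff_def z_def)
    then show ?thesis using box_sign[OF \<phi>_box[of "S - {i}"], of m] True
      by (simp add: c_def right_diff_distrib)
  next
    case False
    then have "J $ m $ i = \<phi> (vertex (insert i S)) $ m - z $ m"
      by (simp add: J_def edge_diff_def z_def)
    then show ?thesis using box_sign[OF \<phi>_box[of "insert i S"], of m] False by (simp add: c_def)
  qed
  \<comment> \<open>With these signs an off-diagonal entry of \<open>M ** J = mat 1\<close> is a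
    vanishing sum of nonnegative products, so each product is zero. The factor \<open>s m\<close>
    enters twice and cancels.\<close>
  have J0: "J $ j $ i = 0" if "M $ l $ j \<noteq> 0" "i \<noteq> l" for i l
  proof -
    have "0 = c l * c i * (M ** J) $ l $ i" using that(2) by (simp add: MJ mat_def)
    also have "\<dots> = (\<Sum>m\<in>UNIV. (c l * s m * M $ l $ m) * (c i * s m * J $ m $ i))"
      unfolding matrix_matrix_mult_def by (simp add: sum_distrib_left s_def) (rule sum.cong, auto)
    finally have "\<forall>m\<in>UNIV. (c l * s m * M $ l $ m) * (c i * s m * J $ m $ i) = 0"
      by (subst sum_nonneg_eq_0_iff[symmetric])
        (simp_all only: finite mult_nonneg_nonneg[OF M_sign J_sign])
    then have "(c l * s j * M $ l $ j) * (c i * s j * J $ j $ i) = 0" by blast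
    moreover have "c l \<noteq> 0" "c i \<noteq> 0" "s j \<noteq> 0" by (auto simp: c_def s_def)
    ultimately show ?thesis using that(1) by simp
  qed
  \<comment> \<open>Every index i differs from k or from k', so row j of \<open>J\<close> is zero,
    contradicting invertibility.\<close>
  have "J $ j $ i = 0" for i
    using J0[of k i] J0[of k' i] nz \<open>k \<noteq> k'\<close> by (auto simp: M_def J_def)
  then have "(J ** M) $ j $ j = 0" by (simp add: matrix_matrix_mult_def)
  then show False by (simp add: JM mat_def)
qed

section \<open>Nodal interpolation\<close>

lemma fe_mesh_element:
  assumes "fe_mesh \<Omega> T \<Phi>" "K \<in> T"
  shows "q1_map (\<Phi> K)" "bij_betw (\<Phi> K) ref_cube K"
  using assms by (auto simp: fe_mesh_def q1_map_iff_components)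

lemma fe_space_iff:
  "v \<in> fe_space \<Omega> T \<Phi> \<longleftrightarrow> v \<in> extensional (closure \<Omega>) \<and> continuous_on (closure \<Omega>) v \<and>
     (\<forall>K\<in>T. q1_map (v \<circ> \<Phi> K))"
  by (simp add: fe_space_def q1_map_iff_components o_def)

text \<open>The action on vertex sets of the symmetry of the cube given by \<open>\<pi>\<close> and \<open>A\<close>.\<close>

definition sym_set :: "('d \<Rightarrow> 'd) \<Rightarrow> 'd set \<Rightarrow> 'd set \<Rightarrow> 'd set" where
  "sym_set \<pi> A S = {i. \<pi> i \<in> S \<longleftrightarrow> i \<notin> A}"

lemma bij_sym_set:
  assumes "bij \<pi>"
  shows "bij (sym_set \<pi> A)"
proof (rule bijI)
  show "inj (sym_set \<pi> A)"
  proof (rule injI)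
    fix S R assume eq: "sym_set \<pi> A S = sym_set \<pi> A R"
    have "\<pi> i \<in> S \<longleftrightarrow> \<pi> i \<in> R" for i
      using eq by (auto simp: sym_set_def set_eq_iff)
    then show "S = R" using bij_is_surj[OF assms] by (metis set_eqI surjD)
  qed
  have "R = sym_set \<pi> A (\<pi> ` {i. i \<in> R \<longleftrightarrow> i \<notin> A})" for R
    using bij_is_inj[OF assms] by (auto simp: sym_set_def inj_image_mem_iff)
  then show "surj (sym_set \<pi> A)" by (rule surjI[OF sym])
qed

text \<open>A reflection swaps the two possible factors at a coordinate, and \<open>sym_set\<close>
  swaps membership accordingly; the permutation only reorders the product.\<close>

lemma shape_sym_set:
  fixes y :: "real^'d"
  assumes "bij \<pi>"
  shows "shape (sym_set \<pi> A S) (\<chi> i. if i \<in> A then 1 - y $ \<pi> i else y $ \<pi> i) = shape S y"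
proof -
  have "shape (sym_set \<pi> A S) (\<chi> i. if i \<in> A then 1 - y $ \<pi> i else y $ \<pi> i)
      = (\<Prod>i\<in>UNIV. if \<pi> i \<in> S then y $ \<pi> i else 1 - y $ \<pi> i)"
    unfolding shape_def by (rule prod.cong) (auto simp: sym_set_def)
  also have "\<dots> = shape S y"
    unfolding shape_def by (rule prod.reindex_bij_betw[OF assms])
  finally show ?thesis .
qed

text \<open>Conformity makes the elementwise interpolants agree on common faces: only the shape functions
  of the vertices of a face do not vanish on it.\<close>

lemma conforming_interpolant_eq:
  fixes f :: "real^'d \<Rightarrow> 'a::real_vector"
  assumes mesh: "fe_mesh \<Omega> T \<Phi>" and K: "K \<in> T" "K' \<in> T"
    and y: "y \<in> ref_cube" "y' \<in> ref_cube" "\<Phi> K y = \<Phi> K' y'"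
  shows "(\<Sum>S\<in>UNIV. shape S y *\<^sub>R f (\<Phi> K (vertex S))) = (\<Sum>S\<in>UNIV. shape S y' *\<^sub>R f (\<Phi> K' (vertex S)))"
proof (cases "K = K'")
  case True
  then have "y = y'"
    using fe_mesh_element(2)[OF mesh K(1)] y by (auto simp: bij_betw_def dest: inj_onD)
  with True show ?thesis by simp
next
  case False
  note bij = fe_mesh_element(2)[OF mesh K(1)] fe_mesh_element(2)[OF mesh K(2)]
  have x: "\<Phi> K y \<in> K \<inter> K'"
    using bij_betwE[OF bij(1)] bij_betwE[OF bij(2)] y by auto
  obtain F g where F: "ref_face F" "ref_symmetry g" "K \<inter> K' = \<Phi> K ` F"
      "\<And>y. y \<in> F \<Longrightarrow> \<Phi> K' (g y) = \<Phi> K y"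
    using mesh K False x unfolding fe_mesh_def conforming_def by (metis empty_iff)
  obtain B b where B: "F = {y \<in> ref_cube. \<forall>i\<in>B. y $ i = vertex b $ i}"
    using F(1) unfolding ref_face_def ref_vertices_eq by blast
  obtain \<pi> A where g: "bij \<pi>" "g = (\<lambda>y. \<chi> i. if i \<in> A then 1 - y $ (\<pi> i) else y $ (\<pi> i))"
    using F(2) unfolding ref_symmetry_def by blast
  have "y \<in> F"
  proof -
    obtain u where "u \<in> F" "\<Phi> K y = \<Phi> K u" using x F(3) by auto
    then have "y = u" using y(1) bij(1) B by (auto simp: bij_betw_def dest: inj_onD)
    with \<open>u \<in> F\<close> show ?thesis by simp
  qed
  have g_cube: "g u \<in> ref_cube" if "u \<in> ref_cube" for u
    using that by (auto simp: g ref_cube_def)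
  have "\<Phi> K' (g y) = \<Phi> K' y'" using F(4)[OF \<open>y \<in> F\<close>] y(3) by simp
  then have y': "y' = g y"
    using g_cube[OF y(1)] y(2) bij(2) by (auto simp: bij_betw_def dest: inj_onD)
  have g_vertex: "g (vertex S) = vertex (sym_set \<pi> A S)" for S
    by (auto simp: g vec_eq_iff sym_set_def)
  have face: "shape S y *\<^sub>R f (\<Phi> K (vertex S)) = shape S y *\<^sub>R f (\<Phi> K' (vertex (sym_set \<pi> A S)))" for S
  proof (cases "vertex S \<in> F")
    case True
    then show ?thesis using F(4) g_vertex by metis
  next
    case False
    then obtain i where "i \<in> B" "vertex S $ i \<noteq> vertex b $ i" by (auto simp: B)
    moreover then have "y $ i = vertex b $ i" using \<open>y \<in> F\<close> B by blast
    ultimately have "shape S y = 0"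
      unfolding shape_def by (intro prod_zero bexI[of _ i]) (auto split: if_splits)
    then show ?thesis by simp
  qed
  have "(\<Sum>S\<in>UNIV. shape S y' *\<^sub>R f (\<Phi> K' (vertex S)))
      = (\<Sum>S\<in>UNIV. shape (sym_set \<pi> A S) (g y) *\<^sub>R f (\<Phi> K' (vertex (sym_set \<pi> A S))))"
    unfolding y' by (rule sum.reindex_bij_betw[OF bij_sym_set[OF g(1)], symmetric])
  also have "\<dots> = (\<Sum>S\<in>UNIV. shape S y *\<^sub>R f (\<Phi> K (vertex S)))"
    by (simp only: face) (simp add: g shape_sym_set)
  finally show ?thesis by simp
qed

text \<open>The elementwise interpolants are glued: they agree where elements meet, and continuity
  passes from the finitely many closed elements to their union.\<close>

lemma fe_interpolant_exists:
  assumes mesh: "fe_mesh \<Omega> T \<Phi>"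
  shows "\<exists>v\<in>fe_space \<Omega> T \<Phi>. \<forall>z\<in>mesh_vertices T \<Phi>. v z = f z"
proof -
  let ?q = "\<lambda>K y. \<Sum>S\<in>UNIV. shape S y *\<^sub>R f (\<Phi> K (vertex S))"
  \<comment> \<open>\<open>SOME\<close> picks an arbitrary element containing x; by
    \<open>conforming_interpolant_eq\<close> the value does not depend on the pick.
    \<open>restrict\<close> provides the value \<open>undefined\<close> that
    \<open>extensional\<close> demands outside the closure.\<close>
  define v where "v = restrict (\<lambda>x. let K = SOME K. K \<in> T \<and> x \<in> K in ?q K (inv_into ref_cube (\<Phi> K) x)) (closure \<Omega>)"
  have cl: "closure \<Omega> = \<Union>T" and fin: "finite T" using mesh by (auto simp: fe_mesh_def)
  have vq: "v (\<Phi> K y) = ?q K y" if K: "K \<in> T" and y: "y \<in> ref_cube" for K y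
  proof -
    define K' where "K' = (SOME K'. K' \<in> T \<and> \<Phi> K y \<in> K')"
    have x: "\<Phi> K y \<in> K" using fe_mesh_element(2)[OF mesh K] y by (auto simp: bij_betw_def)
    then have K': "K' \<in> T" "\<Phi> K y \<in> K'"
      unfolding K'_def using someI[of "\<lambda>K'. K' \<in> T \<and> \<Phi> K y \<in> K'" K] K by auto
    note bij = fe_mesh_element(2)[OF mesh K'(1)]
    have "inv_into ref_cube (\<Phi> K') (\<Phi> K y) \<in> ref_cube"
      using bij_betwE[OF bij_betw_inv_into[OF bij]] K'(2) by blast
    moreover have "\<Phi> K y = \<Phi> K' (inv_into ref_cube (\<Phi> K') (\<Phi> K y))"
      using bij_betw_inv_into_right[OF bij K'(2)] by simp
    ultimately have "?q K y = ?q K' (inv_into ref_cube (\<Phi> K') (\<Phi> K y))"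
      by (rule conforming_interpolant_eq[OF mesh K K'(1) y])
    then show ?thesis
      using x K by (auto simp: v_def cl Let_def K'_def)
  qed
  then have vv: "v (\<Phi> K (vertex S)) = f (\<Phi> K (vertex S))" if "K \<in> T" for K S
    using that sum_shape_vertex[where a = "\<lambda>S. f (\<Phi> K (vertex S))"] by simp
  have q1: "q1_map (v \<circ> \<Phi> K)" if "K \<in> T" for K
    using vq[OF that] vv[OF that] by (simp add: q1_map_def)
  have cont: "continuous_on K v" and closed: "closed K" if K: "K \<in> T" for K
  proof -
    note elt = fe_mesh_element[OF mesh K]
    have "compact (\<Phi> K ` ref_cube)"
      by (rule compact_continuous_image[OF q1_map_continuous_on[OF elt(1)] compact_ref_cube])
    then show "closed K" using elt(2) by (simp add: bij_betw_def compact_imp_closed)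
    have "inv_into ref_cube (\<Phi> K) ` K = ref_cube"
      using bij_betw_inv_into[OF elt(2)] by (simp add: bij_betw_def)
    then have "continuous_on K ((v \<circ> \<Phi> K) \<circ> inv_into ref_cube (\<Phi> K))"
      using continuous_on_compose[OF continuous_on_inv_elt_map[OF elt]] q1_map_continuous_on[OF q1[OF K]]
      by metis
    then show "continuous_on K v"
      by (rule continuous_on_eq) (simp add: bij_betw_inv_into_right[OF elt(2)])
  qed
  have "continuous_on (closure \<Omega>) v"
    unfolding cl using continuous_on_closed_Union[OF fin, of "\<lambda>K. K" v] closed cont by simp
  then have "v \<in> fe_space \<Omega> T \<Phi>"
    unfolding fe_space_iff using q1 by (simp add: v_def)
  with vv show ?thesis
    by (auto simp: mesh_vertices_def elt_vertices_def ref_vertices_eq)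
qed

text \<open>Uniqueness behind the \<open>THE\<close> in \<open>nodal_interpolation\<close>: vertex
  values fix a Q1 function on every element, the elements cover the closure, and outside it both
  functions are \<open>undefined\<close>.\<close>

lemma fe_space_eqI:
  assumes mesh: "fe_mesh \<Omega> T \<Phi>" and v: "v \<in> fe_space \<Omega> T \<Phi>" "w \<in> fe_space \<Omega> T \<Phi>"
    and eq: "\<And>z. z \<in> mesh_vertices T \<Phi> \<Longrightarrow> v z = w z"
  shows "v = w"
proof (rule extensionalityI)
  show "v \<in> extensional (closure \<Omega>)" "w \<in> extensional (closure \<Omega>)"
    using v by (auto simp: fe_space_iff)
  fix x assume "x \<in> closure \<Omega>"
  then obtain K where K: "K \<in> T" "x \<in> K" using mesh by (auto simp: fe_mesh_def)
  then obtain y where y: "y \<in> ref_cube" "x = \<Phi> K y"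
    using fe_mesh_element(2)[OF mesh K(1)] by (auto simp: bij_betw_def)
  have "v (\<Phi> K (vertex S)) = w (\<Phi> K (vertex S))" for S
    using K(1) by (intro eq) (auto simp: mesh_vertices_def elt_vertices_def ref_vertices_eq)
  then have "(v \<circ> \<Phi> K) y = (w \<circ> \<Phi> K) y"
    using v K(1) y(1) unfolding fe_space_iff q1_map_def by (metis (no_types, lifting) comp_apply sum.cong)
  then show "v x = w x" using y(2) by simp
qed

lemma nodal_interpolation_props:
  assumes "fe_mesh \<Omega> T \<Phi>"
  shows "nodal_interpolation \<Omega> T \<Phi> f \<in> fe_space \<Omega> T \<Phi>"
    and "z \<in> mesh_vertices T \<Phi> \<Longrightarrow> nodal_interpolation \<Omega> T \<Phi> f z = f z"
proof -
  have "\<exists>!v. v \<in> fe_space \<Omega> T \<Phi> \<and> (\<forall>z\<in>mesh_vertices T \<Phi>. v z = f z)"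
    using fe_interpolant_exists[OF assms] fe_space_eqI[OF assms] by (metis (no_types, lifting))
  from theI'[OF this] show "nodal_interpolation \<Omega> T \<Phi> f \<in> fe_space \<Omega> T \<Phi>"
    and "z \<in> mesh_vertices T \<Phi> \<Longrightarrow> nodal_interpolation \<Omega> T \<Phi> f z = f z"
    unfolding nodal_interpolation_def by auto
qed

section \<open>Comparison of the gradients\<close>

text \<open>With p = |a| |b|, the squared distance of the normalised vectors is 2 (p - a.b) / p. The
  numerator is nonnegative by Cauchy-Schwarz and p >= 1, so dropping p cannot decrease it; adding
  (|a| - |b|)^2 gives |a - b|^2.\<close>

lemma norm_normalize_diff_le:
  fixes a b :: "'a::real_inner"
  assumes "norm a \<ge> 1" "norm b \<ge> 1"
  shows "norm (inverse (norm a) *\<^sub>R a - inverse (norm b) *\<^sub>R b) \<le> norm (a - b)"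
proof -
  let ?p = "norm a * norm b"
  have ab: "norm a > 0" "norm b > 0" using assms by linarith+
  have p: "?p \<ge> 1" using mult_mono[OF assms] by simp
  have "(norm (inverse (norm a) *\<^sub>R a - inverse (norm b) *\<^sub>R b))\<^sup>2 = 2 * (?p - a \<bullet> b) / ?p"
    using ab by (simp add: power2_norm_eq_inner inner_diff inner_commute[of b a] field_simps)
      (simp add: power2_norm_eq_inner[symmetric] power2_eq_square)
  also have "\<dots> \<le> 2 * (?p - a \<bullet> b)"
    using p norm_cauchy_schwarz[of a b] by (simp add: divide_le_eq mult_le_cancel_left1)
  also have "\<dots> \<le> (norm a - norm b)\<^sup>2 + 2 * (?p - a \<bullet> b)" by simp
  also have "\<dots> = (norm (a - b))\<^sup>2"
    by (simp add: power2_diff power2_norm_eq_inner inner_diff inner_commute[of b a])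
  finally show ?thesis by (simp add: power2_le_iff_abs_le)
qed

lemma vertex_gradient_bounds:
  fixes \<Phi> :: "(real^'d) set \<Rightarrow> real^'d \<Rightarrow> real^'d"
  assumes mesh: "fe_mesh \<Omega> T \<Phi>" and sr: "shape_regular \<sigma> T \<Phi>" and \<sigma>: "\<sigma> > 0"
    and w: "w \<in> fe_space \<Omega> T \<Phi>" "\<And>z. z \<in> mesh_vertices T \<Phi> \<Longrightarrow> norm (w z) \<ge> 1"
    and K: "K \<in> T" and z: "z \<in> elt_vertices \<Phi> K"
  defines "u \<equiv> nodal_interpolation \<Omega> T \<Phi> (\<lambda>x. inverse (norm (w x)) *\<^sub>R w x)"
  shows "norm (jacobian u (at z within K)) \<le> \<sigma>\<^sup>2 * norm (jacobian w (at z within K))"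
    and "cartesian_tensor_product T \<Longrightarrow>
           norm (jacobian u (at z within K)) \<le> norm (jacobian w (at z within K))"
proof -
  obtain S where S: "z = \<Phi> K (vertex S)"
    using z by (auto simp: elt_vertices_def ref_vertices_eq)
  note elt = fe_mesh_element[OF mesh K]
  define J where "J = edge_diff (\<Phi> K) S"
  define M where "M = matrix_inv J"
  have J: "invertible J" "norm J \<le> \<sigma> * diameter K" "norm M \<le> \<sigma> / diameter K"
    using sr K unfolding shape_regular_def Let_def
    by (auto simp: J_def M_def simp flip: elt_jacobian_vertex[OF elt(1)])
  have q1: "q1_map (u \<circ> \<Phi> K)" "q1_map (w \<circ> \<Phi> K)"
    using nodal_interpolation_props(1)[OF mesh] w(1) K by (auto simp: fe_space_iff u_def)
  note jac = jacobian_at_vertex[OF elt J(1)[unfolded J_def], folded S J_def, folded M_def]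
  have vert: "\<Phi> K (vertex R) \<in> mesh_vertices T \<Phi>" for R
    using K by (auto simp: mesh_vertices_def elt_vertices_def ref_vertices_eq)
  define Du where "Du = edge_diff (u \<circ> \<Phi> K) S"
  define Dw where "Dw = edge_diff (w \<circ> \<Phi> K) S"
  have col: "norm (column k Du) \<le> norm (column k Dw)" for k
    unfolding Du_def Dw_def column_edge_diff
    using norm_normalize_diff_le[OF w(2)[OF vert] w(2)[OF vert]]
    by (simp add: u_def nodal_interpolation_props(2)[OF mesh vert])
  have "norm J * norm M \<le> (\<sigma> * diameter K) * (\<sigma> / diameter K)"
    using J(2,3) order_trans[OF norm_ge_zero J(2)] by (intro mult_mono) simp_all
  \<comment> \<open>The inequality also covers diameter 0, where division by zero gives 0.\<close>
  also have "\<dots> \<le> \<sigma>\<^sup>2" by (simp add: power2_eq_square)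
  finally have JM: "norm J * norm M \<le> \<sigma>\<^sup>2" .
  have "norm (Du ** M) \<le> norm Du * norm M" by (rule norm_matrix_mult_le)
  also have "\<dots> \<le> norm Dw * norm M"
    by (intro mult_right_mono norm_le_columnwise col) simp
  \<comment> \<open>Returning from the reference gradient to the physical one costs
    \<open>norm J\<close>, which pairs with \<open>norm M\<close> to the product bounded
    before.\<close>
  also have "Dw = (Dw ** M) ** J"
    using matrix_inv_both(2)[OF J(1)] by (simp add: M_def flip: matrix_mul_assoc)
  also have "norm ((Dw ** M) ** J) * norm M \<le> norm (Dw ** M) * norm J * norm M"
    by (intro mult_right_mono norm_matrix_mult_le) simp
  also have "\<dots> \<le> norm (Dw ** M) * \<sigma>\<^sup>2"
    unfolding mult.assoc by (intro mult_left_mono JM) simp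
  finally show "norm (jacobian u (at z within K)) \<le> \<sigma>\<^sup>2 * norm (jacobian w (at z within K))"
    by (simp add: jac q1 Du_def Dw_def mult.commute)
  assume "cartesian_tensor_product T"
  then obtain a b where ab: "K = cbox a b" "\<And>i. a $ i < b $ i"
    using K unfolding cartesian_tensor_product_def consecutive_def by blast
  have "norm (Du ** M) \<le> norm (Dw ** M)"
  proof (rule norm_mult_le_monomial[OF col])
    have "bij_betw (\<Phi> K) ref_cube (cbox a b)" using elt(2) ab(1) by simp
    from matrix_inv_jacobian_box_monomial[OF elt(1) this J(1)[unfolded J_def] ab(2)]
    show "k = k'" if "M $ k $ j \<noteq> 0" "M $ k' $ j \<noteq> 0" for j k k'
      using that unfolding M_def J_def .
  qed
  then show "norm (jacobian u (at z within K)) \<le> norm (jacobian w (at z within K))"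
    by (simp add: jac q1 Du_def Dw_def)
qed

text \<open>The quadrature weights are nonnegative and depend only on the mesh, so vertexwise bounds
  can be squared and summed.\<close>

lemma discrete_grad_norm_sq_mono:
  assumes "\<And>K z. K \<in> T \<Longrightarrow> z \<in> elt_vertices \<Phi> K \<Longrightarrow>
      norm (jacobian u (at z within K)) \<le> c * norm (jacobian w (at z within K))"
  shows "discrete_grad_norm_sq T \<Phi> u \<le> c\<^sup>2 * discrete_grad_norm_sq T \<Phi> w"
  unfolding discrete_grad_norm_sq_def sum_distrib_left
proof (intro sum_mono)
  fix K z assume "K \<in> T" "z \<in> elt_vertices \<Phi> K"
  then have "(norm (jacobian u (at z within K)))\<^sup>2 \<le> (c * norm (jacobian w (at z within K)))\<^sup>2"
    by (intro power_mono assms) auto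
  then have "quad_weight \<Phi> K z * (norm (jacobian u (at z within K)))\<^sup>2
      \<le> quad_weight \<Phi> K z * (c * norm (jacobian w (at z within K)))\<^sup>2"
    by (intro mult_left_mono) (auto simp: quad_weight_def)
  then show "quad_weight \<Phi> K z * (norm (jacobian u (at z within K)))\<^sup>2
      \<le> c\<^sup>2 * (quad_weight \<Phi> K z * (norm (jacobian w (at z within K)))\<^sup>2)"
    by (simp add: power_mult_distrib mult_ac)
qed

theorem lemma3p1:
  fixes \<sigma> :: real
  assumes "CARD('d::finite) = 2 \<or> CARD('d) = 3"
    and "\<sigma> > 0"
  shows
    "(\<exists>C>0. \<forall>(\<Omega> :: (real^'d) set) T \<Phi>.
        fe_mesh \<Omega> T \<Phi> \<longrightarrow> shape_regular \<sigma> T \<Phi> \<longrightarrow>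
        (\<forall>w\<in>fe_space \<Omega> T \<Phi>. (\<forall>z\<in>mesh_vertices T \<Phi>. norm (w z) \<ge> 1) \<longrightarrow>
           discrete_grad_norm_sq T \<Phi>
             (nodal_interpolation \<Omega> T \<Phi> (\<lambda>x. inverse (norm (w x)) *\<^sub>R w x))
           \<le> C * discrete_grad_norm_sq T \<Phi> w)) \<and>
     (\<forall>(\<Omega> :: (real^'d) set) T \<Phi>.
        fe_mesh \<Omega> T \<Phi> \<longrightarrow> shape_regular \<sigma> T \<Phi> \<longrightarrow> cartesian_tensor_product T \<longrightarrow>
        (\<forall>w\<in>fe_space \<Omega> T \<Phi>. (\<forall>z\<in>mesh_vertices T \<Phi>. norm (w z) \<ge> 1) \<longrightarrow>
           discrete_grad_norm_sq T \<Phi>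
             (nodal_interpolation \<Omega> T \<Phi> (\<lambda>x. inverse (norm (w x)) *\<^sub>R w x))
           \<le> discrete_grad_norm_sq T \<Phi> w))"
proof (intro conjI exI[of _ "(\<sigma>\<^sup>2)\<^sup>2"] allI impI ballI)
  \<comment> \<open>The vertexwise factor \<open>\<sigma>\<^sup>2\<close> is squared once more in
    the squared seminorm.\<close>
  show "(\<sigma>\<^sup>2)\<^sup>2 > 0" using assms(2) by simp
next
  fix \<Omega> T and \<Phi> :: "(real^'d) set \<Rightarrow> real^'d \<Rightarrow> real^'d" and w
  assume *: "fe_mesh \<Omega> T \<Phi>" "shape_regular \<sigma> T \<Phi>" "w \<in> fe_space \<Omega> T \<Phi>"
    "\<forall>z\<in>mesh_vertices T \<Phi>. norm (w z) \<ge> 1"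
  show "discrete_grad_norm_sq T \<Phi> (nodal_interpolation \<Omega> T \<Phi> (\<lambda>x. inverse (norm (w x)) *\<^sub>R w x))
      \<le> (\<sigma>\<^sup>2)\<^sup>2 * discrete_grad_norm_sq T \<Phi> w"
    by (rule discrete_grad_norm_sq_mono) (rule vertex_gradient_bounds(1)[OF *(1,2) assms(2) *(3)], use *(4) in auto)
next
  fix \<Omega> T and \<Phi> :: "(real^'d) set \<Rightarrow> real^'d \<Rightarrow> real^'d" and w
  assume *: "fe_mesh \<Omega> T \<Phi>" "shape_regular \<sigma> T \<Phi>" "cartesian_tensor_product T"
    "w \<in> fe_space \<Omega> T \<Phi>" "\<forall>z\<in>mesh_vertices T \<Phi>. norm (w z) \<ge> 1"
  have "norm (jacobian (nodal_interpolation \<Omega> T \<Phi> (\<lambda>x. inverse (norm (w x)) *\<^sub>R w x)) (at z within K))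
      \<le> 1 * norm (jacobian w (at z within K))" if "K \<in> T" "z \<in> elt_vertices \<Phi> K" for K z
    using vertex_gradient_bounds(2)[OF *(1,2) assms(2) *(4) _ that *(3)] *(5) by simp
  from discrete_grad_norm_sq_mono[OF this]
  show "discrete_grad_norm_sq T \<Phi> (nodal_interpolation \<Omega> T \<Phi> (\<lambda>x. inverse (norm (w x)) *\<^sub>R w x))
      \<le> discrete_grad_norm_sq T \<Phi> w" by simp
qed

end
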